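(* Let $\mu$ be a finite, log-concave measure on $[0,\infty)$, and for $t>0$ and integers $n\ge0$ let $a_t(n)=\int_0^\infty \frac{x^n}{n!}e^{-tx}\,d\mu(x)$. Then for any non-negative integers $k\le \ell\le m\le n$ with $k+n=\ell+m$ there exists a finite, non-negative measure $\nu=\nu_{k,\ell,m,n}$ on $[0,\infty)$ such that for any $t>0$, $$\int_0^\infty e^{-tx}\,d\nu(x)=a_t(\ell)\,a_t(m)-a_t(k)\,a_t(n).$$
   Context: A function $f:[0,\infty)\to\mathbb{R}$ is log-concave if $f\ge 0$ and $f(\lambda x+(1-\lambda)y)\ge f(x)^\lambda f(y)^{1-\lambda}$ for all $x,y\ge 0$, $0<\lambda<1$. A finite Borel measure $\mu$ on $[0,\infty)$ is log-concave if either $\mu = c\,\delta_{x_0}$ for some $c\ge 0$ and $x_0\in[0,\infty)$, or $\mu$ is absolutely continuous with a log-concave density $f:[0,\infty)\to\mathbb{R}$. The convention $0^0=1$ is used. *)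

theory Defs
  imports "HOL-Probability.Probability"
begin

text \<open>
  Borel measures on \<open>[0,\<infinity>)\<close> are measures whose sigma-algebra is that of \<open>nonneg_borel\<close>;
  their underlying space is then \<open>{0..}\<close>.
\<close>

abbreviation nonneg_borel :: "real measure" where
  "nonneg_borel \<equiv> restrict_space borel {0..}"

text \<open>
  Functions \<open>[0,\<infinity>) \<rightarrow> \<real>\<close> are represented by functions on the reals of which
  only the values on \<open>[0,\<infinity>)\<close> matter. As both exponents are positive, \<open>0 powr a = 0\<close> is
  the usual value here.
\<close>

definition log_concave_fun :: "(real \<Rightarrow> real) \<Rightarrow> bool" where
  "log_concave_fun f \<longleftrightarrow>
     (\<forall>x\<ge>0. 0 \<le> f x) \<and>
     (\<forall>x\<ge>0. \<forall>y\<ge>0. \<forall>r. 0 < r \<and> r < 1 \<longrightarrow>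
        f (r * x + (1 - r) * y) \<ge> f x powr r * f y powr (1 - r))"

definition log_concave_measure :: "real measure \<Rightarrow> bool" where
  "log_concave_measure M \<longleftrightarrow>
     (\<exists>c\<ge>0. \<exists>x0\<ge>0. M = scale_measure (ennreal c) (return nonneg_borel x0)) \<or>
     (\<exists>f \<in> borel_measurable nonneg_borel. log_concave_fun f \<and>
        M = density (restrict_space lborel {0..}) (\<lambda>x. ennreal (f x)))"

text \<open>In \<open>x ^ n\<close> the convention \<open>0 ^ 0 = 1\<close> is the one of the library.\<close>

definition laplace_coeff :: "real measure \<Rightarrow> real \<Rightarrow> nat \<Rightarrow> real" where
  "laplace_coeff M t n = (\<integral>x. x ^ n / fact n * exp (- t * x) \<partial>M)"

end

theory Submission
  imports Defs
begin

text \<open>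
  Suppose that \<open>\<mu>\<close> has the log-concave density \<open>f\<close>, extended by \<open>0\<close> to the negative reals. A product
  \<open>a\<^sub>t(i) a\<^sub>t(j)\<close> of Laplace transforms is the Laplace transform of a convolution, whose value at \<open>s\<close> is
  \<open>g\<^sub>i\<^sub>j(s) = \<integral> x^i / i! (s - x)^j / j! h(x) dx\<close> with \<open>h(x) = f(x) f(s - x)\<close>
  (\<open>lborel_convolution\<close>; here \<open>g\<^sub>i\<^sub>j\<close> is \<open>moment_convolution\<close>). So \<open>\<nu>\<close> must have the density
  \<open>g\<^sub>l\<^sub>m - g\<^sub>k\<^sub>n\<close>, and the point is that this function is nonnegative and integrable.

  For nonnegativity, the pair \<open>(l, m)\<close> is reached from \<open>(k, n)\<close> by steps \<open>(i, j + 1) \<rightarrow> (i + 1, j)\<close>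
  with \<open>i \<le> j\<close> (\<open>balancing_mono\<close>), so one such step is enough (\<open>moment_convolution_step\<close>). The
  product \<open>h\<close> is invariant under the reflection \<open>x \<mapsto> s - x\<close> and quasi-concave
  (\<open>log_concave_reflected_product\<close>), so each nonempty set \<open>{h > r}\<close> with \<open>r \<ge> 0\<close> is, up to its end points, an interval
  \<open>[a, s - a]\<close>. Writing \<open>h\<close> as an integral of indicators of these sets
  (\<open>integral_nonneg_if_superlevels_nonneg\<close>) replaces \<open>h\<close> by such an interval. The difference of the two
  beta kernels of a step has the primitive \<open>F(x) = - x^(i+1) (s - x)^(j+1) / ((i+1)! (j+1)!)\<close>, and
  \<open>F(s - a) - F(a) \<ge> 0\<close> because \<open>a \<le> s - a\<close> and \<open>i \<le> j\<close>
  (\<open>beta_kernel_difference_symmetric_interval\<close>).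

  Integrability up to \<open>t = 0\<close>, which makes \<open>\<nu>\<close> finite, requires all moments of \<open>\<mu>\<close> to be finite:
  an integrable log-concave function decays exponentially
  (\<open>log_concave_moments_integrable\<close>).

  If \<open>\<mu> = c \<delta>\<^sub>x\<close>, then the difference of products is a multiple of \<open>exp (- 2 t x)\<close>, so that \<open>\<nu>\<close> is an
  atom at \<open>2 x\<close>; its mass is nonnegative because \<open>l! m! \<le> k! n!\<close>, by the same balancing
  steps.
\<close>

section \<open>Balancing pairs of exponents\<close>

lemma balancing_mono:
  fixes A :: "nat \<Rightarrow> nat \<Rightarrow> 'a::preorder"
  assumes step: "\<And>i j. i \<le> j \<Longrightarrow> A i (Suc j) \<le> A (Suc i) j"
    and "k \<le> l" "l \<le> m" "k + n = l + m"
  shows "A k n \<le> A l m"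
proof -
  obtain d where d: "l = k + d"
    using \<open>k \<le> l\<close> le_Suc_ex by blast
  have "k + d \<le> m' \<Longrightarrow> A k (m' + d) \<le> A (k + d) m'" for m'
  proof (induction d arbitrary: m')
    case (Suc d)
    have "A k (Suc m' + d) \<le> A (k + d) (Suc m')"
      using Suc by (intro Suc.IH) simp
    also have "\<dots> \<le> A (Suc (k + d)) m'"
      using Suc.prems by (intro step) simp
    finally show ?case by simp
  qed simp
  moreover have "n = m + d"
    using d assms by simp
  ultimately show ?thesis
    using d \<open>l \<le> m\<close> by simp
qed

lemma fact_mult_mono:
  fixes k l m n :: nat
  assumes "k \<le> l" "l \<le> m" "k + n = l + m"
  shows "1 / (fact k * fact n :: real) \<le> 1 / (fact l * fact m)"
proof (rule balancing_mono[where A = "\<lambda>i j. 1 / (fact i * fact j :: real)", OF _ assms])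
  fix i j :: nat
  assume "i \<le> j"
  then have "(fact (Suc i) * fact j :: real) \<le> fact i * fact (Suc j)"
    by (simp add: mult_right_mono algebra_simps)
  then show "1 / (fact i * fact (Suc j) :: real) \<le> 1 / (fact (Suc i) * fact j)"
    by (intro divide_left_mono) (auto simp del: fact_Suc)
qed

section \<open>Point masses\<close>

lemma Dirac_laplace_difference:
  fixes k l m n :: nat
  assumes x0: "0 \<le> x0" and c: "0 \<le> c"
    and ord: "k \<le> l" "l \<le> m" "k + n = l + m"
    and \<mu>: "\<mu> = scale_measure (ennreal c) (return nonneg_borel x0)"
  shows "\<exists>\<nu> :: real measure. finite_measure \<nu> \<and> sets \<nu> = sets nonneg_borel \<and>
           (\<forall>t>0. (\<integral>x. exp (- t * x) \<partial>\<nu>) =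
              laplace_coeff \<mu> t l * laplace_coeff \<mu> t m
                - laplace_coeff \<mu> t k * laplace_coeff \<mu> t n)"
proof -
  have int_atom: "(\<integral>x. g x \<partial>scale_measure (ennreal C) (return nonneg_borel y)) = C * g y"
    if "0 \<le> C" "0 \<le> y" and g[measurable]: "g \<in> borel_measurable borel" for C y and g :: "real \<Rightarrow> real"
  proof -
    have "scale_measure (ennreal C) (return nonneg_borel y) = density (return nonneg_borel y) (\<lambda>_. ennreal C)"
      by (rule measure_eqI) (auto simp: emeasure_density_const)
    moreover have "g \<in> borel_measurable nonneg_borel"
      by (rule measurable_restrict_space1) measurable
    ultimately show ?thesis
      using that by (simp add: integral_density integral_return space_restrict_space)
  qed
  have coeff: "laplace_coeff \<mu> t i = c * (x0 ^ i / fact i * exp (- t * x0))" for t i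
    unfolding laplace_coeff_def \<mu> using x0 c by (subst int_atom) auto
  define C where "C = c\<^sup>2 * x0 ^ (l + m) * (1 / (fact l * fact m) - 1 / (fact k * fact n))"
  have "0 \<le> C"
    unfolding C_def using x0 fact_mult_mono[OF ord] by (intro mult_nonneg_nonneg) auto
  define \<nu> where "\<nu> = scale_measure (ennreal C) (return nonneg_borel (2 * x0))"
  have "finite_measure \<nu>"
    unfolding \<nu>_def using x0
    by (intro finite_measureI) (simp add: space_scale_measure space_restrict_space sets_restrict_space_iff emeasure_return
        ennreal_mult_eq_top_iff)
  moreover have "sets \<nu> = sets nonneg_borel"
    by (simp add: \<nu>_def)
  moreover have "(\<integral>x. exp (- t * x) \<partial>\<nu>) =
      laplace_coeff \<mu> t l * laplace_coeff \<mu> t m - laplace_coeff \<mu> t k * laplace_coeff \<mu> t n" for t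
  proof -
    have "x0 ^ k * x0 ^ n = x0 ^ l * x0 ^ m"
      using ord by (simp flip: power_add)
    then have kn: "x0 ^ k / fact k * (x0 ^ n / fact n) = x0 ^ (l + m) * (1 / (fact k * fact n))"
      by (simp add: power_add)
    have lm: "x0 ^ l / fact l * (x0 ^ m / fact m) = x0 ^ (l + m) * (1 / (fact l * fact m))"
      by (simp add: power_add)
    have prod: "laplace_coeff \<mu> t i * laplace_coeff \<mu> t j =
        c\<^sup>2 * exp (- t * (2 * x0)) * (x0 ^ i / fact i * (x0 ^ j / fact j))" for i j
    proof -
      have "exp (- t * (2 * x0)) = exp (- t * x0) * exp (- t * x0)"
        by (simp flip: exp_add)
      then show ?thesis
        by (simp only: coeff power2_eq_square mult_ac)
    qed
    have "(\<integral>x. exp (- t * x) \<partial>\<nu>) = C * exp (- t * (2 * x0))"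
      unfolding \<nu>_def using \<open>0 \<le> C\<close> x0 by (subst int_atom) auto
    then show ?thesis
      unfolding prod kn lm C_def by (simp only: right_diff_distrib left_diff_distrib mult_ac)
  qed
  ultimately show ?thesis by blast
qed

section \<open>Beta kernels against symmetric quasi-concave weights\<close>

text \<open>
  This is the layer-cake formula with a signed integrand: \<open>h x\<close> is the length of \<open>{0..<h x}\<close>, and Fubini
  turns \<open>\<integral> K h\<close> into the integral over \<open>r \<ge> 0\<close> of the integrals of \<open>K\<close> over \<open>{h > r}\<close>. The
  interchange is justified because \<open>\<bar>K\<bar> h\<close> is exactly the inner integral of the absolute values.
\<close>

lemma integral_nonneg_if_superlevels_nonneg:
  fixes K h :: "'a \<Rightarrow> real"
  assumes "sigma_finite_measure M"
    and [measurable]: "K \<in> borel_measurable M" "h \<in> borel_measurable M"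
    and h: "\<And>x. 0 \<le> h x"
    and int: "integrable M (\<lambda>x. K x * h x)"
    and superlevel: "\<And>r. 0 \<le> r \<Longrightarrow> 0 \<le> (\<integral>x. indicator {x. r < h x} x * K x \<partial>M)"
  shows "0 \<le> (\<integral>x. K x * h x \<partial>M)"
proof -
  interpret M: sigma_finite_measure M by fact
  interpret P: pair_sigma_finite M "lborel :: real measure" ..
  define H where "H x r = (if 0 \<le> r \<and> r < h x then K x else 0)" for x r
  have H_r: "H x = (\<lambda>r. K x * indicator {0..<h x} r)" for x
    by (auto simp: H_def)
  have "integrable (M \<Otimes>\<^sub>M lborel) (case_prod H)"
  proof (rule P.Fubini_integrable)
    show "case_prod H \<in> borel_measurable (M \<Otimes>\<^sub>M lborel)"
      unfolding H_def[abs_def] by measurable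
    have "(\<integral>r. norm (H x r) \<partial>lborel) = \<bar>K x * h x\<bar>" for x
      using h[of x] by (simp add: H_r abs_mult)
    then show "integrable M (\<lambda>x. \<integral>r. norm (case_prod H (x, r)) \<partial>lborel)"
      using int by simp
    have "integrable lborel (\<lambda>r. K x * indicator {0..<h x} r)" for x
      using h[of x] by (intro integrable_mult_right integrable_real_indicator) auto
    then show "AE x in M. integrable lborel (\<lambda>r. case_prod H (x, r))"
      by (intro AE_I2) (simp add: H_r)
  qed
  from P.Fubini_integral[OF this]
  have swap: "(\<integral>r. (\<integral>x. H x r \<partial>M) \<partial>lborel) = (\<integral>x. (\<integral>r. H x r \<partial>lborel) \<partial>M)" .
  have inner: "(\<integral>r. H x r \<partial>lborel) = K x * h x" for x
    using h[of x] by (simp add: H_r)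
  have level: "0 \<le> (\<integral>x. H x r \<partial>M)" for r
  proof (cases "0 \<le> r")
    case True
    then have "(\<lambda>x. H x r) = (\<lambda>x. indicator {x. r < h x} x * K x)"
      by (auto simp: H_def)
    then show ?thesis
      using superlevel[OF True] by simp
  qed (simp add: H_def)
  have "0 \<le> (\<integral>r. (\<integral>x. H x r \<partial>M) \<partial>lborel)"
    by (rule integral_nonneg_AE, rule AE_I2, rule level)
  then show ?thesis
    by (simp only: swap inner)
qed

text \<open>
  The kernel has an explicit primitive, so its integral over \<open>[a, s - a]\<close> is, up to a positive factor,
  \<open>a^(i+1) (s - a)^(j+1) - (s - a)^(i+1) a^(j+1)\<close>. The set \<open>S\<close> differs from such an interval at most
  by the two end points.
\<close>

lemma beta_kernel_difference_symmetric_interval: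
  fixes S :: "real set" and s :: real
  assumes [measurable]: "S \<in> sets borel" and S: "S \<subseteq> {0..s}"
    and interval: "\<And>x y z. x \<in> S \<Longrightarrow> y \<in> S \<Longrightarrow> x \<le> z \<Longrightarrow> z \<le> y \<Longrightarrow> z \<in> S"
    and sym: "\<And>x. x \<in> S \<Longrightarrow> s - x \<in> S"
    and "i \<le> j"
  shows "0 \<le> (\<integral>x. indicator S x *
            (x ^ Suc i / fact (Suc i) * ((s - x) ^ j / fact j)
              - x ^ i / fact i * ((s - x) ^ Suc j / fact (Suc j))) \<partial>lborel)"
    (is "0 \<le> (\<integral>x. _ * ?K x \<partial>lborel)")
proof (cases "S = {}")
  case False
  then obtain y where y: "y \<in> S" by blast
  define a where "a = Inf S"
  have bdd: "bdd_below S"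
    using S by (meson bdd_below_Icc bdd_below_mono)
  have lower: "a \<le> x" if "x \<in> S" for x
    unfolding a_def using bdd that by (rule cInf_lower[rotated])
  have "0 \<le> a"
    unfolding a_def using False S by (intro cInf_greatest) auto
  have "a \<le> s - a"
    using lower[OF y] lower[OF sym[OF y]] by linarith
  have inner: "x \<in> S" if "a < x" "x < s - a" for x
  proof -
    obtain u where u: "u \<in> S" "u < x"
      using cInf_lessD[OF False] \<open>a < x\<close> unfolding a_def by blast
    obtain v where v: "v \<in> S" "v < s - x"
      using cInf_lessD[OF False, of "s - x"] \<open>x < s - a\<close> unfolding a_def by auto
    show ?thesis
      using interval[OF u(1) sym[OF v(1)], of x] u v by simp
  qed
  have outer: "a \<le> x \<and> x \<le> s - a" if "x \<in> S" for x
    using lower[OF that] lower[OF sym[OF that]] by simp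
  define F where "F x = - (x ^ Suc i / fact (Suc i) * ((s - x) ^ Suc j / fact (Suc j)))" for x
  have "(\<integral>x. indicator S x * ?K x \<partial>lborel) = (\<integral>x. ?K x * indicator {a..s - a} x \<partial>lborel)"
  proof (rule integral_cong_AE)
    show "AE x in lborel. indicator S x * ?K x = ?K x * indicator {a..s - a} x"
      using AE_lborel_singleton[of a] AE_lborel_singleton[of "s - a"]
    proof eventually_elim
      case (elim x)
      then show ?case
        using inner[of x] outer[of x] by (cases "x \<in> S") (auto simp: indicator_def)
    qed
  qed measurable
  also have "\<dots> = F (s - a) - F a"
  proof (rule integral_FTC_Icc_real)
    fix x :: real
    have D: "((\<lambda>x. x ^ Suc p / fact (Suc p)) has_real_derivative x ^ p / fact p) (at x)" for p and x :: real
      using DERIV_cdivide[OF DERIV_pow[of "Suc p" x], of "fact (Suc p)"]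
      by (simp del: power_Suc of_nat_Suc)
    have "((\<lambda>x. (s - x) ^ Suc p / fact (Suc p)) has_real_derivative (s - x) ^ p / fact p * - 1) (at x)" for p
      by (rule DERIV_chain2[OF D]) (auto intro!: derivative_eq_intros)
    from DERIV_minus[OF DERIV_mult[OF D[of i x] this[of j]]]
    \<comment> \<open>With the factorials included, differentiating \<open>x^(p+1) / (p+1)!\<close> only lowers \<open>p + 1\<close> to \<open>p\<close>, so
      the product rule yields the two beta kernels without further constants.\<close>
    show "DERIV F x :> ?K x"
      unfolding F_def[abs_def] by (rule DERIV_cong) (simp add: algebra_simps)
  qed (use \<open>a \<le> s - a\<close> in auto)
  also have "0 \<le> F (s - a) - F a"
  proof -
    obtain d where d: "j = i + d"
      using \<open>i \<le> j\<close> le_Suc_ex by blast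
    have "a ^ d \<le> (s - a) ^ d"
      using \<open>0 \<le> a\<close> \<open>a \<le> s - a\<close> by (intro power_mono)
    then have "(a * (s - a)) ^ Suc i * a ^ d \<le> (a * (s - a)) ^ Suc i * (s - a) ^ d"
      using \<open>0 \<le> a\<close> \<open>a \<le> s - a\<close> by (intro mult_left_mono) auto
    then have "(s - a) ^ Suc i * a ^ Suc j \<le> a ^ Suc i * (s - a) ^ Suc j"
      by (simp add: d power_mult_distrib power_add ac_simps)
    then have "(s - a) ^ Suc i * a ^ Suc j / (fact (Suc i) * fact (Suc j)) \<le> a ^ Suc i * (s - a) ^ Suc j / (fact (Suc i) * fact (Suc j))"
      by (intro divide_right_mono) auto
    then show ?thesis
      unfolding F_def by (simp del: fact_Suc power_Suc)
  qed
  finally show ?thesis .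
qed simp

section \<open>Convolutions and moments\<close>

lemma lborel_convolution:
  fixes p q :: "real \<Rightarrow> real"
  assumes p: "integrable lborel p" and q: "integrable lborel q"
  shows "integrable lborel (\<lambda>s. \<integral>x. p x * q (s - x) \<partial>lborel)" (is ?int)
    and "(\<integral>s. (\<integral>x. p x * q (s - x) \<partial>lborel) \<partial>lborel) = (\<integral>x. p x \<partial>lborel) * (\<integral>x. q x \<partial>lborel)" (is ?eq)
proof -
  have [measurable]: "p \<in> borel_measurable borel" "q \<in> borel_measurable borel"
    using p q by (auto dest: borel_measurable_integrable)
  have shift_int: "integrable lborel (\<lambda>s. g (s - x))" if "integrable lborel g" for g :: "real \<Rightarrow> real" and x
    using lborel_integrable_real_affine[OF that, of 1 "- x"] by simp
  have shift: "(\<integral>s. g (s - x) \<partial>lborel) = (\<integral>s. g s \<partial>lborel)" for g :: "real \<Rightarrow> real" and x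
    using lborel_integral_real_affine[of 1 g "- x"] by simp
  have H: "integrable (lborel \<Otimes>\<^sub>M lborel) (case_prod (\<lambda>x s. p x * q (s - x)))"
  proof (rule lborel_pair.Fubini_integrable)
    have "(\<integral>s. norm (p x * q (s - x)) \<partial>lborel) = \<bar>p x\<bar> * (\<integral>s. \<bar>q s\<bar> \<partial>lborel)" for x
      using shift[of "\<lambda>s. \<bar>q s\<bar>" x] by (simp add: abs_mult)
    then show "integrable lborel (\<lambda>x. \<integral>s. norm (case_prod (\<lambda>x s. p x * q (s - x)) (x, s)) \<partial>lborel)"
      using p by simp
  qed (use shift_int[OF q] in auto)
  show ?int
    using lborel_pair.integrable_snd[OF H] .
  show ?eq
    unfolding lborel_pair.Fubini_integral[OF H] by (simp add: shift)
qed

text \<open>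
  If \<open>f\<close> ever drops, from \<open>x0\<close> to \<open>x1\<close>, then log-concavity forces \<open>ln f\<close> to stay below the line
  through the two points beyond \<open>x1\<close>, and this line has negative slope.
\<close>

lemma log_concave_exponential_decay:
  assumes f: "log_concave_fun f" and "0 \<le> x0" "x0 < x1" and less: "f x1 < f x0"
  shows "\<exists>C\<ge>0. \<exists>c>0. \<forall>x>x1. f x \<le> C * exp (- c * x)"
proof -
  \<comment> \<open>Since \<open>f x1\<close> may be \<open>0\<close>, the line is drawn through the larger positive value \<open>q\<close> at \<open>x1\<close>.\<close>
  define A q where "A = f x0" and "q = (f x0 + f x1) / 2"
  have "0 \<le> f x1"
    using f assms by (simp add: log_concave_fun_def)
  then have q: "0 < q" "q < A" "f x1 \<le> q"
    using less by (auto simp: q_def A_def)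
  define c where "c = ln (A / q) / (x1 - x0)"
  have "0 < c"
    using q assms by (simp add: c_def)
  have "f x \<le> (A * exp (c * x0)) * exp (- c * x)" if "x1 < x" for x
  proof -
    define r where "r = (x1 - x0) / (x - x0)"
    have r: "0 < r" "r < 1"
      using that assms by (auto simp: r_def)
    have "x1 = r * x + (1 - r) * x0"
    proof -
      have "r * (x - x0) = x1 - x0"
        using that assms by (simp add: r_def)
      then show ?thesis
        by (simp add: algebra_simps)
    qed
    moreover have "0 \<le> x" "0 \<le> f x"
      using f that assms by (auto simp: log_concave_fun_def)
    ultimately have "f x powr r * A powr (1 - r) \<le> f x1"
      using f r \<open>0 \<le> x0\<close> unfolding log_concave_fun_def A_def by metis
    then have "f x powr r * A powr (1 - r) \<le> q"
      using q by simp
    then have "(f x / A) powr r \<le> q / A"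
      using q \<open>0 \<le> f x\<close> by (simp add: powr_divide powr_diff field_simps)
    then have "((f x / A) powr r) powr (1 / r) \<le> (q / A) powr (1 / r)"
      using r by (intro powr_mono2) auto
    then have "f x / A \<le> (q / A) powr (1 / r)"
      using r q \<open>0 \<le> f x\<close> by (simp add: powr_powr)
    also have "\<dots> = exp (c * x0) * exp (- c * x)"
    proof -
      have ln_q: "ln (q / A) = - (c * (x1 - x0))"
        using q assms by (simp add: c_def ln_div)
      have scale: "1 / r * (c * (x1 - x0)) = c * (x - x0)"
        using that assms by (simp add: r_def)
      have "1 / r * ln (q / A) = - (1 / r * (c * (x1 - x0)))"
        unfolding ln_q by (rule mult_minus_right)
      also have "\<dots> = c * x0 + - c * x"
        unfolding scale by (simp add: algebra_simps)
      finally have "1 / r * ln (q / A) = c * x0 + - c * x" .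
      then show ?thesis
        using q by (simp add: powr_def flip: exp_add)
    qed
    finally show ?thesis
      using q by (simp add: field_simps)
  qed
  moreover have "0 \<le> A * exp (c * x0)"
    using q by simp
  ultimately show ?thesis
    using \<open>0 < c\<close> by blast
qed

text \<open>
  If \<open>f\<close> drops somewhere, it decays exponentially and can be compared with a gamma density.
  Otherwise \<open>f\<close> is nondecreasing, and an integrable nondecreasing nonnegative function on a
  half-line vanishes.
\<close>

lemma log_concave_moments_integrable:
  assumes f: "log_concave_fun f"
    and int: "integrable lborel (\<lambda>x. indicator {0..} x * f x)"
  shows "integrable lborel (\<lambda>x. x ^ n * (indicator {0..} x * f x))"
proof -
  have f_nonneg: "0 \<le> f x" if "0 \<le> x" for x
    using f that by (simp add: log_concave_fun_def)
  have [measurable]: "(\<lambda>x. indicator {0..} x * f x) \<in> borel_measurable borel"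
    using int by (auto dest: borel_measurable_integrable)
  show ?thesis
  proof (cases "\<exists>x0\<ge>0. \<exists>x1>x0. f x1 < f x0")
    case True
    then obtain x0 x1 where x: "0 \<le> x0" "x0 < x1" "f x1 < f x0" by blast
    obtain C c where C: "0 \<le> C" "0 < c" "\<And>x. x1 < x \<Longrightarrow> f x \<le> C * exp (- c * x)"
      using log_concave_exponential_decay[OF f x] by blast
    have "integrable lborel (erlang_density n c)"
      using nn_integral_erlang_ith_moment[OF \<open>0 < c\<close>, of n 0] \<open>0 < c\<close>
      by (intro integrableI_nonneg) auto
    then have "integrable lborel (\<lambda>x. x1 ^ n * (indicator {0..} x * f x) + (C * fact n / c ^ Suc n) * erlang_density n c x)"
      using int by (intro Bochner_Integration.integrable_add integrable_mult_right)
    then show ?thesis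
    proof (rule Bochner_Integration.integrable_bound)
      show "AE x in lborel. norm (x ^ n * (indicator {0..} x * f x)) \<le>
          norm (x1 ^ n * (indicator {0..} x * f x) + (C * fact n / c ^ Suc n) * erlang_density n c x)"
      proof (rule AE_I2)
        fix x :: real
        consider "x < 0" | "0 \<le> x" "x \<le> x1" | "0 \<le> x" "x1 < x" by linarith
        then have "\<bar>x ^ n * (indicator {0..} x * f x)\<bar> \<le> x1 ^ n * (indicator {0..} x * f x) + (C * fact n / c ^ Suc n) * erlang_density n c x"
        proof cases
          case 2
          then have "x ^ n * f x \<le> x1 ^ n * f x"
            using f_nonneg[of x] by (intro mult_right_mono power_mono) auto
          moreover have "0 \<le> (C * fact n / c ^ Suc n) * erlang_density n c x"
            using C by simp
          ultimately show ?thesis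
            using 2 f_nonneg[of x] by simp
        next
          case 3
          then have "x ^ n * f x \<le> x ^ n * (C * exp (- c * x))"
            using C by (intro mult_left_mono) auto
          also have "\<dots> = (C * fact n / c ^ Suc n) * erlang_density n c x"
            using 3 C by (simp add: erlang_density_def)
          moreover have "0 \<le> x1 ^ n * f x"
            using x 3 f_nonneg[of x] by simp
          ultimately show ?thesis
            using 3 f_nonneg[of x] by simp
        qed (simp add: erlang_density_def)
        then show "norm (x ^ n * (indicator {0..} x * f x)) \<le>
            norm (x1 ^ n * (indicator {0..} x * f x) + (C * fact n / c ^ Suc n) * erlang_density n c x)"
          by simp
      qed
    qed simp
  next
    case False
    have "f x0 = 0" if "0 \<le> x0" for x0
    proof -
      have "integrable lborel (\<lambda>x. indicator {x0..} x * f x0)"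
        using int
      proof (rule Bochner_Integration.integrable_bound)
        show "AE x in lborel. norm (indicator {x0..} x * f x0) \<le> norm (indicator {0..} x * f x)"
        proof (rule AE_I2)
          fix x
          have "f x0 \<le> f x" if "x0 \<le> x"
            using False \<open>0 \<le> x0\<close> that by (metis not_less order_le_less)
          then show "norm (indicator {x0..} x * f x0) \<le> norm (indicator {0..} x * f x)"
            using \<open>0 \<le> x0\<close> f_nonneg[of x0] f_nonneg[of x] by (auto simp: indicator_def)
        qed
      qed simp
      then have "integrable lborel (\<lambda>x. indicator {x0..} x :: real)" if "f x0 \<noteq> 0"
        using that by simp
      then have finite: "emeasure lborel {x0..} < \<infinity>" if "f x0 \<noteq> 0"
        using that by (simp add: integrable_indicator_iff)
      have long: "ennreal b \<le> emeasure lborel {x0..}" if "0 \<le> b" for b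
      proof -
        have "emeasure lborel {x0..x0 + b} \<le> emeasure lborel {x0..}"
          by (intro emeasure_mono) auto
        then show ?thesis
          using that by simp
      qed
      show ?thesis
      proof (rule ccontr)
        assume "f x0 \<noteq> 0"
        then obtain b where b: "0 \<le> b" "emeasure lborel {x0..} = ennreal b"
          using finite by (cases "emeasure lborel {x0..}") auto
        then show False
          using long[of "b + 1"] by simp
      qed
    qed
    then have "(\<lambda>x. x ^ n * (indicator {0..} x * f x)) = (\<lambda>_. 0)"
      by (auto simp: indicator_def)
    then show ?thesis by simp
  qed
qed

section \<open>Nonnegativity of the convolution density\<close>

text \<open>
  Both factors are log-concave on \<open>{0..s}\<close>, hence so is their product, and quasi-concavity
  follows by bounding the two values of the product from below by their minimum. Outside \<open>{0..s}\<close> the product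
  vanishes, so that the inequality extends to all reals.
\<close>

lemma log_concave_reflected_product:
  fixes f :: "real \<Rightarrow> real" and s :: real
  assumes f: "log_concave_fun f"
    and h_def: "\<And>x. h x = (indicator {0..} x * f x) * (indicator {0..} (s - x) * f (s - x))"
  shows "0 \<le> h x" and "h (s - x) = h x" and "x \<le> z \<Longrightarrow> z \<le> y \<Longrightarrow> min (h x) (h y) \<le> h z"
proof -
  have nonneg: "0 \<le> f x" if "0 \<le> x" for x
    using f that by (simp add: log_concave_fun_def)
  have lc: "f x powr r * f y powr (1 - r) \<le> f (r * x + (1 - r) * y)"
    if "0 \<le> x" "0 \<le> y" "0 < r" "r < 1" for x y r
    using f that by (simp add: log_concave_fun_def)
  have h_in: "h w = f w * f (s - w)" if "0 \<le> w" "w \<le> s" for w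
    using that by (simp add: h_def)
  have h_out: "h w = 0" if "w < 0 \<or> s < w" for w
    using that by (auto simp: h_def)
  show h_nonneg: "0 \<le> h x" for x
    using nonneg[of x] nonneg[of "s - x"] h_in[of x] h_out[of x]
    by (cases "0 \<le> x \<and> x \<le> s") auto
  show "h (s - x) = h x"
    by (simp add: h_def)
  show "min (h x) (h y) \<le> h z" if "x \<le> z" "z \<le> y"
  proof (cases "x = z \<or> z = y \<or> x < 0 \<or> s < y")
    case True
    then have "h x = h z \<or> h y = h z \<or> h x = 0 \<or> h y = 0"
      using h_out[of x] h_out[of y] by blast
    then show ?thesis
      using h_nonneg[of z] by linarith
  next
    case False
    then have xy: "x < z" "z < y" "0 \<le> x" "y \<le> s"
      using that by auto
    define r where "r = (y - z) / (y - x)"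
    have r: "0 < r" "r < 1"
      using xy by (auto simp: r_def)
    have "r * (y - x) = y - z"
      using xy by (simp add: r_def)
    then have z: "z = r * x + (1 - r) * y"
      by (simp add: algebra_simps)
    then have sz: "s - z = r * (s - x) + (1 - r) * (s - y)"
      by (simp add: algebra_simps)
    have fz: "f x powr r * f y powr (1 - r) \<le> f z"
      unfolding z using xy r by (intro lc) auto
    have fsz: "f (s - x) powr r * f (s - y) powr (1 - r) \<le> f (s - z)"
      unfolding sz using xy r by (intro lc) auto
    define \<mu> where "\<mu> = min (h x) (h y)"
    have "0 \<le> \<mu>"
      using h_nonneg by (simp add: \<mu>_def)
    then have "\<mu> = \<mu> powr (r + (1 - r))"
      by simp
    also have "\<dots> = \<mu> powr r * \<mu> powr (1 - r)"
      by (rule powr_add)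
    also have "\<dots> \<le> h x powr r * h y powr (1 - r)"
      using r \<open>0 \<le> \<mu>\<close> by (intro mult_mono powr_mono2) (auto simp: \<mu>_def)
    also have "\<dots> = (f x powr r * f y powr (1 - r)) * (f (s - x) powr r * f (s - y) powr (1 - r))"
      using xy nonneg by (simp add: h_in powr_mult mult_ac)
    also have "\<dots> \<le> f z * f (s - z)"
      using fz fsz xy nonneg[of z] by (intro mult_mono) auto
    also have "\<dots> = h z"
      using xy by (simp add: h_in)
    finally show ?thesis
      by (simp add: \<mu>_def)
  qed
qed

definition moment_convolution :: "(real \<Rightarrow> real) \<Rightarrow> real \<Rightarrow> nat \<Rightarrow> nat \<Rightarrow> real" where
  "moment_convolution f s i j =
     (\<integral>x. (x ^ i / fact i * (indicator {0..} x * f x)) *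
           ((s - x) ^ j / fact j * (indicator {0..} (s - x) * f (s - x))) \<partial>lborel)"

text \<open>
  The weight is bounded by its value at the centre \<open>s / 2\<close>, so the integrals exist for every \<open>s\<close> and
  not only for almost every \<open>s\<close>; this makes the inequality hold everywhere.
\<close>

lemma moment_convolution_step:
  assumes f: "log_concave_fun f"
    and meas[measurable]: "(\<lambda>x. indicator {0..} x * f x) \<in> borel_measurable borel"
    and "i \<le> j"
  shows "moment_convolution f s i (Suc j) \<le> moment_convolution f s (Suc i) j"
proof -
  define h where "h x = (indicator {0..} x * f x) * (indicator {0..} (s - x) * f (s - x))" for x
  note h = log_concave_reflected_product[OF f h_def]
  define B where "B i j x = x ^ i / fact i * ((s - x) ^ j / fact j)" for i j and x :: real
  have [measurable]: "(\<lambda>x. indicator {0..} (s - x) * f (s - x)) \<in> borel_measurable borel"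
    using measurable_compose[OF _ meas, of "\<lambda>x. s - x"] by simp
  have h_meas[measurable]: "h \<in> borel_measurable borel"
    unfolding h_def[abs_def] by measurable
  have B_meas[measurable]: "B i j \<in> borel_measurable borel" for i j
    unfolding B_def[abs_def] by measurable
  have h_supp: "h x = 0" if "x \<notin> {0..s}" for x
    using that by (auto simp: h_def)
  have h_max: "h x \<le> h (s / 2)" for x
    using h(3)[of x "s / 2" "s - x"] h(3)[of "s - x" "s / 2" x] h(2)[of x] by (cases "x \<le> s / 2") auto
  have int: "integrable lborel (\<lambda>x. B i j x * h x)" for i j
  proof -
    have "continuous_on {0..s} (B i j)"
      unfolding B_def[abs_def] by (intro continuous_intros) auto
    then have "integrable lborel (\<lambda>x. indicator {0..s} x *\<^sub>R B i j x)"
      by (intro borel_integrable_compact) auto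
    then have "integrable lborel (\<lambda>x. h (s / 2) * (indicator {0..s} x *\<^sub>R B i j x))"
      by (rule integrable_mult_right)
    then show ?thesis
    proof (rule Bochner_Integration.integrable_bound)
      show "AE x in lborel. norm (B i j x * h x) \<le> norm (h (s / 2) * (indicator {0..s} x *\<^sub>R B i j x))"
      proof (rule AE_I2)
        fix x
        show "norm (B i j x * h x) \<le> norm (h (s / 2) * (indicator {0..s} x *\<^sub>R B i j x))"
          using h(1)[of x] h(1)[of "s / 2"] h_max[of x] h_supp[of x]
          by (cases "x \<in> {0..s}") (auto simp: abs_mult mult.commute[of "h (s / 2)"] intro!: mult_left_mono)
      qed
    qed simp
  qed
  have conv: "moment_convolution f s i j = (\<integral>x. B i j x * h x \<partial>lborel)" for i j
    unfolding moment_convolution_def B_def h_def by (simp add: ac_simps)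
  have "0 \<le> (\<integral>x. (B (Suc i) j x - B i (Suc j) x) * h x \<partial>lborel)"
  proof (rule integral_nonneg_if_superlevels_nonneg)
    show "integrable lborel (\<lambda>x. (B (Suc i) j x - B i (Suc j) x) * h x)"
      using int by (simp only: left_diff_distrib) (intro Bochner_Integration.integrable_diff int)
    fix r :: real
    assume "0 \<le> r"
    show "0 \<le> (\<integral>x. indicator {x. r < h x} x * (B (Suc i) j x - B i (Suc j) x) \<partial>lborel)"
      unfolding B_def
    proof (rule beta_kernel_difference_symmetric_interval)
      show "{x. r < h x} \<in> sets borel"
        by measurable
      show "{x. r < h x} \<subseteq> {0..s}"
        using h_supp \<open>0 \<le> r\<close> by fastforce
    next
      fix x y z
      assume "x \<in> {x. r < h x}" "y \<in> {x. r < h x}" "x \<le> z" "z \<le> y"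
      then show "z \<in> {x. r < h x}"
        using h(3)[of x z y] by auto
    qed (use h(2) \<open>i \<le> j\<close> in auto)
  qed (use h(1) in \<open>auto intro: lborel.sigma_finite_measure_axioms\<close>)
  then show ?thesis
    unfolding conv using int by (simp add: left_diff_distrib)
qed

section \<open>Laplace transforms of log-concave measures\<close>

lemma density_laplace_difference:
  fixes k l m n :: nat
  assumes f: "log_concave_fun f" and meas: "f \<in> borel_measurable nonneg_borel"
    and \<mu>: "\<mu> = density (restrict_space lborel {0..}) (\<lambda>x. ennreal (f x))"
    and fin: "finite_measure \<mu>"
    and ord: "k \<le> l" "l \<le> m" "k + n = l + m"
  shows "\<exists>\<nu> :: real measure. finite_measure \<nu> \<and> sets \<nu> = sets nonneg_borel \<and>
           (\<forall>t>0. (\<integral>x. exp (- t * x) \<partial>\<nu>) =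
              laplace_coeff \<mu> t l * laplace_coeff \<mu> t m
                - laplace_coeff \<mu> t k * laplace_coeff \<mu> t n)"
proof -
  have meas'[measurable]: "f \<in> borel_measurable (restrict_space lborel {0..})"
    using meas by (simp add: measurable_def space_restrict_space sets_restrict_space)
  have F_meas[measurable]: "(\<lambda>x. indicator {0..} x * f x) \<in> borel_measurable borel"
    using meas by (subst (asm) borel_measurable_restrict_space_iff) auto
  have nonneg: "0 \<le> f x" if "0 \<le> x" for x
    using f that by (simp add: log_concave_fun_def)
  have AE_nonneg: "AE x in restrict_space lborel {0..}. 0 \<le> f x"
    using nonneg by (intro AE_I2) (simp add: space_restrict_space)
  have restrict_meas: "g \<in> borel_measurable (restrict_space lborel {0..})"
    if "g \<in> borel_measurable borel" for g :: "real \<Rightarrow> real"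
    using that by (intro measurable_restrict_space1) simp
  have f_int: "integrable lborel (\<lambda>x. indicator {0..} x * f x)"
  proof -
    have "integrable \<mu> (\<lambda>_. 1 :: real)"
      using finite_measure.integrable_const[OF fin] .
    then show ?thesis
      unfolding \<mu> using AE_nonneg by (simp add: integrable_density integrable_restrict_space)
  qed
  define p where "p t i x = exp (- t * x) * (x ^ i / fact i * (indicator {0..} x * f x))" for t x :: real and i
  have coeff: "laplace_coeff \<mu> t i = (\<integral>x. p t i x \<partial>lborel)" for t i
    unfolding laplace_coeff_def \<mu> p_def using AE_nonneg
    by (subst integral_density) (auto simp: integral_restrict_space ac_simps intro!: restrict_meas)
  have p_int: "integrable lborel (p t i)" if "0 \<le> t" for t i
  proof (rule Bochner_Integration.integrable_bound)
    show "integrable lborel (\<lambda>x. x ^ i * (indicator {0..} x * f x))"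
      by (rule log_concave_moments_integrable[OF f f_int])
    show "AE x in lborel. norm (p t i x) \<le> norm (x ^ i * (indicator {0..} x * f x))"
    proof (rule AE_I2)
      fix x :: real
      have "exp (- t * x) / fact i * (x ^ i * f x) \<le> 1 * (x ^ i * f x)" if "0 \<le> x"
      proof (rule mult_right_mono)
        have "exp (- t * x) \<le> 1"
          using \<open>0 \<le> t\<close> that by simp
        also have "1 \<le> (fact i :: real)"
          by (rule fact_ge_1)
        finally show "exp (- t * x) / fact i \<le> 1"
          by simp
      qed (use that nonneg in auto)
      then show "norm (p t i x) \<le> norm (x ^ i * (indicator {0..} x * f x))"
        using nonneg[of x] by (cases "0 \<le> x") (auto simp: p_def abs_mult)
    qed
    show "p t i \<in> borel_measurable lborel"
      unfolding p_def[abs_def] by measurable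
  qed
  \<comment> \<open>The exponential weights combine to \<open>exp (- t s)\<close>, which leaves a convolution that does not depend
    on \<open>t\<close>; this is why one measure \<open>\<nu>\<close> serves all \<open>t\<close>.\<close>
  have conv: "(\<integral>x. p t i x * p t j (s - x) \<partial>lborel) = exp (- t * s) * moment_convolution f s i j" for t s i j
  proof -
    have e: "exp (- t * s) = exp (- t * x) * exp (- t * (s - x))" for x
      by (simp add: algebra_simps flip: exp_add)
    then have "p t i x * p t j (s - x) = exp (- t * s) *
        ((x ^ i / fact i * (indicator {0..} x * f x)) *
           ((s - x) ^ j / fact j * (indicator {0..} (s - x) * f (s - x))))" for x
      unfolding p_def e[of x] by (simp only: mult_ac)
    then show ?thesis
      unfolding moment_convolution_def by simp
  qed
  have conv_int: "integrable lborel (\<lambda>s. exp (- t * s) * moment_convolution f s i j)"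
    and conv_eq: "(\<integral>s. exp (- t * s) * moment_convolution f s i j \<partial>lborel) = laplace_coeff \<mu> t i * laplace_coeff \<mu> t j"
    if "0 \<le> t" for t i j
    using lborel_convolution[OF p_int[OF that, of i] p_int[OF that, of j]] unfolding conv coeff by auto
  define g where "g s = moment_convolution f s l m - moment_convolution f s k n" for s
  have g_nonneg: "0 \<le> g s" for s
    unfolding g_def
    using balancing_mono[where A = "moment_convolution f s", OF moment_convolution_step[OF f F_meas] ord] by simp
  have g_supp: "g s = 0" if "s < 0" for s
  proof -
    have "moment_convolution f s i j = 0" for i j
      unfolding moment_convolution_def using that
      by (intro integral_eq_zero_AE AE_I2) (auto simp: indicator_def)
    then show ?thesis
      by (simp add: g_def)
  qed
  have g_int: "integrable lborel g"
    \<comment> \<open>At \<open>t = 0\<close> the exponential factor disappears.\<close>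
    unfolding g_def[abs_def] using conv_int[of 0] by auto
  then have g_meas: "g \<in> borel_measurable borel"
    by (auto dest: borel_measurable_integrable)
  define \<nu> where "\<nu> = density (restrict_space lborel {0..}) (\<lambda>s. ennreal (g s))"
  have \<nu>_int: "(\<integral>x. u x \<partial>\<nu>) = (\<integral>s. u s * g s \<partial>lborel)"
    if "u \<in> borel_measurable borel" for u :: "real \<Rightarrow> real"
  proof -
    have "(\<integral>x. u x \<partial>\<nu>) = (\<integral>s. indicator {0..} s * (g s * u s) \<partial>lborel)"
      unfolding \<nu>_def using g_meas that g_nonneg
      by (subst integral_density) (auto simp: integral_restrict_space intro!: restrict_meas)
    also have "\<dots> = (\<integral>s. u s * g s \<partial>lborel)"
      using g_supp by (intro Bochner_Integration.integral_cong) (auto simp: indicator_def)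
    finally show ?thesis .
  qed
  have "finite_measure \<nu>"
  proof (rule finite_measureI)
    have "emeasure \<nu> (space \<nu>) = (\<integral>\<^sup>+s. ennreal (g s) \<partial>restrict_space lborel {0..})"
      unfolding \<nu>_def using restrict_meas[OF g_meas]
      by (subst emeasure_density) (auto simp: sets_restrict_space_iff intro!: nn_integral_cong)
    also have "\<dots> = (\<integral>\<^sup>+s. ennreal (g s) * indicator {0..} s \<partial>lborel)"
      by (simp add: nn_integral_restrict_space)
    also have "\<dots> \<le> (\<integral>\<^sup>+s. ennreal (g s) \<partial>lborel)"
      by (intro nn_integral_mono) (auto simp: indicator_def)
    also have "\<dots> < \<infinity>"
      using g_int g_nonneg by (simp add: nn_integral_eq_integral)
    finally show "emeasure \<nu> (space \<nu>) \<noteq> \<infinity>"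
      by simp
  qed
  moreover have "sets \<nu> = sets nonneg_borel"
    by (simp add: \<nu>_def sets_restrict_space)
  moreover have "(\<integral>x. exp (- t * x) \<partial>\<nu>) =
      laplace_coeff \<mu> t l * laplace_coeff \<mu> t m - laplace_coeff \<mu> t k * laplace_coeff \<mu> t n"
    if "0 < t" for t
    using that conv_int[of t] conv_eq[of t] by (subst \<nu>_int) (auto simp: g_def right_diff_distrib)
  ultimately show ?thesis by blast
qed

theorem theorem1p5:
  fixes \<mu> :: "real measure" and k l m n :: nat
  assumes "finite_measure \<mu>"
    and "sets \<mu> = sets nonneg_borel"
    and "log_concave_measure \<mu>"
    and "k \<le> l" and "l \<le> m" and "m \<le> n" and "k + n = l + m"
  shows "\<exists>\<nu> :: real measure. finite_measure \<nu> \<and> sets \<nu> = sets nonneg_borel \<and>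
           (\<forall>t>0. (\<integral>x. exp (- t * x) \<partial>\<nu>) =
              laplace_coeff \<mu> t l * laplace_coeff \<mu> t m
                - laplace_coeff \<mu> t k * laplace_coeff \<mu> t n)"
  using \<open>log_concave_measure \<mu>\<close> unfolding log_concave_measure_def
proof (elim disjE exE bexE conjE)
  fix c x0
  assume "0 \<le> c" "0 \<le> x0" "\<mu> = scale_measure (ennreal c) (return nonneg_borel x0)"
  then show ?thesis
    using assms by (intro Dirac_laplace_difference) auto
next
  fix f
  assume "f \<in> borel_measurable nonneg_borel" "log_concave_fun f"
    "\<mu> = density (restrict_space lborel {0..}) (\<lambda>x. ennreal (f x))"
  then show ?thesis
    using assms by (intro density_laplace_difference) auto
qed

end
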